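(* Let $\mu$ be a partition with at most $n$ parts and $\mathbf a\in\mathbb N^n$. Then the sum $\sum_U\operatorname{sgn}(U)$, taken over special snake tabloids $U$ of weight $\mathbf a$ and shape $\mathrm{rev}(\mu)=(\mu_n,\dots,\mu_1)$, is cancellation-free, i.e. its terms are not both positive and negative.
   Context: Cells $(c,r)$: column $c$, row $r$, row 1 at the bottom. For $\mathbf b\in\mathbb N^n$, $\mathbb D(\mathbf b)=\{(c,r)\in\mathbb Z_{>0}\times[n]:c\le\mathbf b_r\}$. Key poset: $\mathbf a\preceq\mathbf b$ iff $\mathbf a_i\le\mathbf b_i$ for all $i$, and $\mathbf a_i>\mathbf a_j$ with $i<j$ implies $\mathbf b_i>\mathbf b_j$. Two cells are weakly connected if they share a column or lie in adjacent columns with the left cell weakly higher; a set is weakly connected if it forms a single class under the transitive closure of this relation. A snake of $\mathbf b$ is $S\subseteq\mathbb D(\mathbf b)$ such that (1) $S$ is weakly connected, (2) $\mathbb D(\mathbf b)\setminus S=\mathbb D(\mathbf a)$ for some $\mathbf a\preceq\mathbf b$, (3) $S$ contains no three cells $(c,s),(c+1,s),(c+1,r)$ with $r<s$. A snake is special if it is empty or contains the lowest cell of column 1 of the key diagram. A special snake tabloid $U=(S_1,\dots,S_n)$ of shape $\mathbf b$ is a decomposition $\mathbb D(\mathbf b)=S_1\sqcup\cdots\sqcup S_n$ such that each $S_i$ is a special snake of the key diagram $\mathbb D(\mathbf b)\setminus(S_1\sqcup\cdots\sqcup S_{i-1})$, with $S_i=\emptyset$ if and only if row $i$ of that diagram is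 empty. Its weight is $(|S_1|,\dots,|S_n|)$. The height of a snake is the number of rows containing a cell of it (height of $\emptyset$ is 1), its sign is $(-1)^{\mathrm{height}-1}$, and $\operatorname{sgn}(U)$ is the product of the signs of its snakes. *)

theory Defs
  imports Main
begin

type_synonym cell = "nat \<times> nat"

text \<open>Weak compositions of length \<open>n\<close> are lists of length \<open>n\<close>. Cells are pairs (column, row), both
  counted from 1, so the entry belonging to row \<open>r\<close> is \<open>b ! (r - 1)\<close>.\<close>

definition key_diagram :: "nat list \<Rightarrow> cell set" where
  "key_diagram b = {(c, r). 1 \<le> c \<and> 1 \<le> r \<and> r \<le> length b \<and> c \<le> b ! (r - 1)}"

definition key_le :: "nat list \<Rightarrow> nat list \<Rightarrow> bool" where
  "key_le a b \<longleftrightarrow> length a = length b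
     \<and> (\<forall>i < length b. a ! i \<le> b ! i)
     \<and> (\<forall>i j. i < j \<and> j < length b \<and> a ! i > a ! j \<longrightarrow> b ! i > b ! j)"

definition weakly_adjacent :: "cell \<Rightarrow> cell \<Rightarrow> bool" where
  "weakly_adjacent x y \<longleftrightarrow>
     fst x = fst y
     \<or> (fst y = fst x + 1 \<and> snd x \<ge> snd y)
     \<or> (fst x = fst y + 1 \<and> snd y \<ge> snd x)"

text \<open>The transitive closure is taken inside \<open>S\<close>. The empty set counts as weakly connected, since
  the empty set has to be a (special) snake.\<close>

definition weakly_connected :: "cell set \<Rightarrow> bool" where
  "weakly_connected S \<longleftrightarrow>
     (\<forall>x \<in> S. \<forall>y \<in> S. (x, y) \<in> {(u, v). u \<in> S \<and> v \<in> S \<and> weakly_adjacent u v}\<^sup>+)"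

definition snake :: "nat list \<Rightarrow> cell set \<Rightarrow> bool" where
  "snake b S \<longleftrightarrow>
     S \<subseteq> key_diagram b
     \<and> weakly_connected S
     \<and> (\<exists>a. key_le a b \<and> key_diagram b - S = key_diagram a)
     \<and> \<not> (\<exists>c r s. r < s \<and> (c, s) \<in> S \<and> (c + 1, s) \<in> S \<and> (c + 1, r) \<in> S)"

definition special_snake :: "nat list \<Rightarrow> cell set \<Rightarrow> bool" where
  "special_snake b S \<longleftrightarrow>
     snake b S
     \<and> (S = {} \<or> (\<exists>r. (1, r) \<in> S \<and> (\<forall>r'. (1, r') \<in> key_diagram b \<longrightarrow> r \<le> r')))"

text \<open>The list \<open>U\<close> represents \<open>(S\<^sub>1, \<dots>, S\<^sub>n)\<close> with \<open>S\<^sub>i = U ! (i - 1)\<close>; below, \<open>i\<close> is 0-based, so the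
  corresponding row is \<open>i + 1\<close>. The list \<open>d\<close> is the (unique) composition whose key diagram is what
  remains after removing the earlier snakes.\<close>

definition special_snake_tabloid :: "nat list \<Rightarrow> cell set list \<Rightarrow> bool" where
  "special_snake_tabloid b U \<longleftrightarrow>
     length U = length b
     \<and> key_diagram b = \<Union> (set U)
     \<and> (\<forall>i j. i < j \<and> j < length U \<longrightarrow> U ! i \<inter> U ! j = {})
     \<and> (\<forall>i < length b. \<exists>d. length d = length b
          \<and> key_diagram d = key_diagram b - (\<Union>j<i. U ! j)
          \<and> special_snake d (U ! i)
          \<and> (U ! i = {} \<longleftrightarrow> \<not> (\<exists>c. (c, i + 1) \<in> key_diagram d)))"

definition weight :: "cell set list \<Rightarrow> nat list" where
  "weight U = map card U"

definition height :: "cell set \<Rightarrow> nat" where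
  "height S = (if S = {} then 1 else card (snd ` S))"

definition snake_sign :: "cell set \<Rightarrow> int" where
  "snake_sign S = (- 1) ^ (height S - 1)"

definition tabloid_sign :: "cell set list \<Rightarrow> int" where
  "tabloid_sign U = prod_list (map snake_sign U)"

definition special_snake_tabloids :: "nat list \<Rightarrow> nat list \<Rightarrow> cell set list set" where
  "special_snake_tabloids b a = {U. special_snake_tabloid b U \<and> weight U = a}"

text \<open>The sum of \<open>f\<close> over \<open>A\<close> is cancellation-free.\<close>

definition cancellation_free :: "('u \<Rightarrow> int) \<Rightarrow> 'u set \<Rightarrow> bool" where
  "cancellation_free f A \<longleftrightarrow> \<not> ((\<exists>x \<in> A. f x > 0) \<and> (\<exists>y \<in> A. f y < 0))"

end

(* A special snake of a weakly increasing key diagram is a rim hook starting at the lowest cell of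
   column 1: if the snake meets row k, then in each row above the starting row, up to and
   including row k, exactly (length of the row below) - 1 cells survive. Hence the special snakes
   of such a diagram form a chain under inclusion and are determined by their cardinality. As
   removing a snake leaves a weakly increasing diagram, a special snake tabloid of weakly increasing
   shape is determined by its weight, so the sum has at most one term. *)

theory Submission
  imports Defs
begin

lemma Suc_mem_key_diagram:
  "(c, Suc i) \<in> key_diagram b \<longleftrightarrow> 1 \<le> c \<and> i < length b \<and> c \<le> b ! i"
  by (auto simp: key_diagram_def)

lemma key_diagramE:
  assumes "x \<in> key_diagram b"
  obtains c i where "x = (c, Suc i)" "1 \<le> c" "i < length b" "c \<le> b ! i"
proof -
  obtain c r where x: "x = (c, r)"
    by (cases x)
  with assms have "1 \<le> r"
    by (simp add: key_diagram_def)
  then obtain i where "r = Suc i"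
    by (cases r) auto
  with x assms that show thesis
    by (simp add: Suc_mem_key_diagram)
qed

lemma finite_key_diagram: "finite (key_diagram b)"
proof (rule finite_subset)
  show "key_diagram b \<subseteq> {..sum_list b} \<times> {..length b}"
  proof
    fix x assume "x \<in> key_diagram b"
    then obtain c i where "x = (c, Suc i)" "i < length b" "c \<le> b ! i"
      by (elim key_diagramE)
    moreover from \<open>i < length b\<close> have "b ! i \<le> sum_list b"
      by (rule elem_le_sum_list)
    ultimately show "x \<in> {..sum_list b} \<times> {..length b}"
      by auto
  qed
qed auto

text \<open>This identifies the compositions \<open>d\<close> that the definition of a tabloid
  supplies only existentially. Equal lengths matter, since trailing zeros leave no trace in the
  diagram.\<close>

lemma key_diagram_inject:
  assumes "key_diagram a = key_diagram b" "length a = length b"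
  shows "a = b"
proof (rule nth_equalityI)
  fix i assume i: "i < length a"
  have eq: "1 \<le> c \<and> c \<le> a ! i \<longleftrightarrow> 1 \<le> c \<and> c \<le> b ! i" for c
    using Suc_mem_key_diagram[of c i a] Suc_mem_key_diagram[of c i b] assms i by auto
  show "a ! i = b ! i"
    using eq[of "a ! i"] eq[of "b ! i"] by (cases "a ! i"; cases "b ! i") auto
qed fact

text \<open>A strict descent in \<open>a\<close> would force one in \<open>b\<close>. Hence removing
  a snake from a weakly increasing diagram leaves a weakly increasing one.\<close>

lemma key_le_sorted:
  assumes "key_le a b" "sorted b"
  shows "sorted a"
  unfolding sorted_iff_nth_mono_less
proof (intro allI impI)
  fix i j assume ij: "i < j" "j < length a"
  then have "b ! i \<le> b ! j"
    using assms by (auto simp: key_le_def intro: sorted_nth_mono)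
  then show "a ! i \<le> a ! j"
    using assms(1) ij unfolding key_le_def by (metis not_less)
qed

text \<open>A path inside \<open>S\<close> from \<open>x\<close> to \<open>y\<close> has to leave
  \<open>A\<close> at some step.\<close>

lemma weakly_connected_cut:
  assumes conn: "weakly_connected S" and x: "x \<in> S" "x \<in> A" and y: "y \<in> S" "y \<notin> A"
  obtains u v where "u \<in> S" "u \<in> A" "v \<in> S" "v \<notin> A" "weakly_adjacent u v"
proof -
  let ?R = "{(u, v). u \<in> S \<and> v \<in> S \<and> weakly_adjacent u v}"
  have "(x, y) \<in> ?R\<^sup>+"
    using conn x(1) y(1) by (simp add: weakly_connected_def)
  then have "y \<notin> A \<longrightarrow> (\<exists>u v. u \<in> S \<and> u \<in> A \<and> v \<in> S \<and> v \<notin> A \<and> weakly_adjacent u v)"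
    by (induction rule: trancl_induct) (use x(2) in blast)+
  with y(2) that show thesis
    by blast
qed

text \<open>The snake meets the rows with indices \<open>p\<close> and \<open>k\<close>.
  Connectedness forces consecutive rows of it in between to overlap in a column, which bounds
  \<open>a ! j\<close> from above; an overlap of two or more columns would contain the forbidden
  triple.\<close>

lemma snake_row_length:
  assumes sorted: "sorted d" and le: "key_le a d" and conn: "weakly_connected (key_diagram d - key_diagram a)"
    and no3: "\<not> (\<exists>c r s. r < s \<and> (c, s) \<in> key_diagram d - key_diagram a
                \<and> (c + 1, s) \<in> key_diagram d - key_diagram a
                \<and> (c + 1, r) \<in> key_diagram d - key_diagram a)"
    and p: "a ! p < d ! p" and k: "k < length d" "a ! k < d ! k" and j: "p < j" "j \<le> k"
  shows "Suc (a ! j) = d ! (j - 1)"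
proof -
  define S where "S = key_diagram d - key_diagram a"
  have len: "length a = length d" and le': "\<And>i. i < length d \<Longrightarrow> a ! i \<le> d ! i"
    using le by (auto simp: key_le_def)
  have sorted_a: "sorted a"
    using le sorted by (rule key_le_sorted)
  have mem: "(c, Suc i) \<in> S \<longleftrightarrow> i < length d \<and> a ! i < c \<and> c \<le> d ! i" for c i
    by (auto simp: S_def Suc_mem_key_diagram len)
  have mono: "d ! i \<le> d ! i'" "a ! i \<le> a ! i'" if "i \<le> i'" "i' < length d" for i i'
    using that sorted sorted_a by (auto intro: sorted_nth_mono simp: len)
  have less: "a ! i < d ! (i - 1)" if i: "p < i" "i \<le> k" for i
  proof (rule ccontr)
    assume "\<not> a ! i < d ! (i - 1)"
    then have ge: "d ! (i - 1) \<le> a ! i"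
      by simp
    have S1: "(d ! p, Suc p) \<in> S"
      using p k i by (auto simp: mem)
    have S2: "(d ! k, Suc k) \<in> S"
      using k by (auto simp: mem)
    \<comment> \<open>Rows are 1-based, so the cut \<open>snd x \<le> i\<close> separates the
      indices below \<open>i\<close> from those at least \<open>i\<close>.\<close>
    obtain u v where uv: "u \<in> S" "u \<in> {x. snd x \<le> i}" "v \<in> S" "v \<notin> {x. snd x \<le> i}"
        "weakly_adjacent u v"
      by (rule weakly_connected_cut[of S _ "{x. snd x \<le> i}", OF _ S1 _ S2])
        (use conn i in \<open>auto simp: S_def\<close>)
    from uv(1) obtain c l where u: "u = (c, Suc l)" "l < length d" "c \<le> d ! l"
      by (auto simp: S_def elim: key_diagramE)
    from uv(3) obtain c' l' where v: "v = (c', Suc l')" "l' < length d"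
      by (auto simp: S_def elim: key_diagramE)
    have l: "l \<le> i - 1" "i \<le> l'" "i - 1 < length d"
      using uv(2,4) u v by auto
    have "a ! l' < c'"
      using uv(3) v mem by blast
    moreover have "d ! l \<le> d ! (i - 1)" "a ! i \<le> a ! l'"
      using mono l v by auto
    \<comment> \<open>Every cell below the cut is strictly left of every cell above it, whereas
      adjacency in neighbouring columns needs the left cell weakly higher.\<close>
    ultimately have "c < c'"
      using u(3) ge by linarith
    with uv(5) u v l i show False
      by (auto simp: weakly_adjacent_def)
  qed
  have hit: "a ! (j - 1) < d ! (j - 1)"
  proof (cases "j - 1 = p")
    case True
    then show ?thesis using p by simp
  next
    case False
    then have "a ! (j - 1) < d ! (j - 1 - 1)"
      using j by (intro less) auto
    also have "\<dots> \<le> d ! (j - 1)"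
      using j k by (intro mono) auto
    finally show ?thesis .
  qed
  have "\<not> Suc (a ! j) < d ! (j - 1)"
  proof
    assume lt: "Suc (a ! j) < d ! (j - 1)"
    \<comment> \<open>Column \<open>c + 1\<close> is the last one of the row below; by
      \<open>lt\<close> the snake contains columns \<open>c\<close> and \<open>c + 1\<close> of row
      index \<open>j\<close>.\<close>
    define c where "c = d ! (j - 1) - 1"
    have "d ! (j - 1) \<le> d ! j"
      using j k by (intro mono) auto
    then have c: "a ! j < c" "c + 1 \<le> d ! j" "c + 1 = d ! (j - 1)"
      using lt by (auto simp: c_def)
    have "(c, Suc j) \<in> S" "(c + 1, Suc j) \<in> S"
      using c j k by (simp_all add: mem)
    moreover have "(c + 1, Suc (j - 1)) \<in> S"
      unfolding mem c(3) using hit j k by simp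
    moreover have "Suc (j - 1) < Suc j"
      using j by simp
    ultimately show False
      using no3 unfolding S_def by blast
  qed
  with less[OF j] show ?thesis
    by simp
qed

text \<open>Otherwise \<open>S\<close> goes strictly beyond \<open>T\<close> in some row
  \<open>k\<close>, and \<open>T\<close> beyond \<open>S\<close> in some row \<open>l\<close>. At
  the lower of these two rows both survivor counts are forced to the same value, yet they differ
  there.\<close>

lemma special_snakes_chain:
  assumes sorted: "sorted d" and "special_snake d S" "special_snake d T"
  shows "S \<subseteq> T \<or> T \<subseteq> S"
proof (rule ccontr)
  assume neg: "\<not> (S \<subseteq> T \<or> T \<subseteq> S)"
  have snakes: "snake d S" "snake d T"
    using assms by (auto simp: special_snake_def)
  obtain r where r: "(1, r) \<in> S" "\<forall>r'. (1, r') \<in> key_diagram d \<longrightarrow> r \<le> r'"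
    using assms neg by (auto simp: special_snake_def)
  obtain r' where r': "(1, r') \<in> T" "\<forall>r''. (1, r'') \<in> key_diagram d \<longrightarrow> r' \<le> r''"
    using assms neg by (auto simp: special_snake_def)
  have "r' = r"
    using r r' snakes unfolding snake_def by (meson antisym subsetD)
  obtain a where a: "key_le a d" "key_diagram d - S = key_diagram a"
    using snakes(1) by (auto simp: snake_def)
  obtain b where b: "key_le b d" "key_diagram d - T = key_diagram b"
    using snakes(2) by (auto simp: snake_def)
  have S: "S = key_diagram d - key_diagram a" and T: "T = key_diagram d - key_diagram b"
    using snakes a b by (auto simp: snake_def)
  have len: "length a = length d" "length b = length d"
    using a b by (auto simp: key_le_def)
  have mem: "(c, Suc i) \<in> S \<longleftrightarrow> i < length d \<and> a ! i < c \<and> c \<le> d ! i"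
    "(c, Suc i) \<in> T \<longleftrightarrow> i < length d \<and> b ! i < c \<and> c \<le> d ! i" for c i
    by (auto simp: S T Suc_mem_key_diagram len)
  obtain p where p: "r = Suc p"
    using r(1) by (auto simp: S elim: key_diagramE)
  \<comment> \<open>Both snakes contain the first cell of row index \<open>p\<close>, hence that
    whole row.\<close>
  have ap: "a ! p = 0" "b ! p = 0" "0 < d ! p"
    using r(1) r'(1) mem[of 1 p] p \<open>r' = r\<close> by auto
  obtain x y where x: "x \<in> S" "x \<notin> T" and y: "y \<in> T" "y \<notin> S"
    using neg by blast
  obtain c k where "x = (c, Suc k)"
    using x(1) by (auto simp: S elim: key_diagramE)
  with x have k: "(c, Suc k) \<in> S" "(c, Suc k) \<notin> T"
    by simp_all
  obtain e l where "y = (e, Suc l)"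
    using y(1) by (auto simp: T elim: key_diagramE)
  with y have l: "(e, Suc l) \<in> T" "(e, Suc l) \<notin> S"
    by simp_all
  \<comment> \<open>In each row a snake is a right-justified segment, so having a cell that the
    other lacks means leaving fewer cells.\<close>
  have kl: "k < length d" "l < length d" "a ! k < d ! k" "b ! l < d ! l" "a ! k < b ! k" "b ! l < a ! l"
    using k l by (auto simp: mem)
  have "p \<le> k" "p \<le> l"
    using r(2)[rule_format, of "Suc k"] r(2)[rule_format, of "Suc l"] p kl
    by (simp_all add: Suc_mem_key_diagram)
  moreover have "k \<noteq> p" "l \<noteq> p"
    using ap kl by auto
  ultimately have m: "p < min k l"
    by simp
  \<comment> \<open>The row \<open>min k l\<close> lies above the common start \<open>p\<close> and
    no higher than either \<open>k\<close> or \<open>l\<close>, so the row-length formula applies to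
    both snakes.\<close>
  have "Suc (a ! min k l) = d ! (min k l - 1)"
    by (rule snake_row_length[where p = p and k = k])
      (use sorted a(1) snakes(1) ap kl m in \<open>simp_all add: snake_def flip: S\<close>)
  moreover have "Suc (b ! min k l) = d ! (min k l - 1)"
    by (rule snake_row_length[where p = p and k = l])
      (use sorted b(1) snakes(2) ap kl m in \<open>simp_all add: snake_def flip: T\<close>)
  ultimately show False
    using kl by (auto simp: min_def split: if_splits)
qed

lemma special_snake_card_inject:
  assumes "sorted d" "special_snake d S" "special_snake d T" "card S = card T"
  shows "S = T"
proof -
  have "finite S" "finite T"
    using assms finite_subset[OF _ finite_key_diagram[of d]]
    by (auto simp: special_snake_def snake_def)
  with special_snakes_chain[OF assms(1-3)] assms(4) show ?thesis
    by (metis card_subset_eq)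
qed

text \<open>Induction on the number of snakes removed: once the earlier snakes agree, the next ones
  are special snakes of equal size in the same sorted diagram.\<close>

lemma special_snake_tabloid_weight_inject:
  assumes sorted: "sorted b"
    and U: "special_snake_tabloid b U" and V: "special_snake_tabloid b V"
    and weight: "weight U = weight V"
  shows "U = V"
proof -
  have len: "length U = length b" "length V = length b"
    using U V by (auto simp: special_snake_tabloid_def)
  have tabloid_step: "\<exists>d. length d = length b
      \<and> key_diagram d = key_diagram b - (\<Union>j<i. W ! j) \<and> special_snake d (W ! i)"
    if "special_snake_tabloid b W" "i < length b" for W i
    using that unfolding special_snake_tabloid_def by meson
  have "(\<forall>j<i. U ! j = V ! j) \<and> (\<exists>d. length d = length b \<and> sorted d
      \<and> key_diagram d = key_diagram b - (\<Union>j<i. U ! j))" if "i \<le> length b" for i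
    using that
  proof (induction i)
    case 0
    then show ?case using sorted by auto
  next
    case (Suc i)
    then obtain d where d: "length d = length b" "sorted d"
        "key_diagram d = key_diagram b - (\<Union>j<i. U ! j)"
      and eq: "\<forall>j<i. U ! j = V ! j"
      by auto
    obtain d1 where d1: "length d1 = length b" "special_snake d1 (U ! i)"
        "key_diagram d1 = key_diagram b - (\<Union>j<i. U ! j)"
      using tabloid_step[OF U, of i] Suc.prems by auto
    obtain d2 where d2: "length d2 = length b" "special_snake d2 (V ! i)"
        "key_diagram d2 = key_diagram b - (\<Union>j<i. V ! j)"
      using tabloid_step[OF V, of i] Suc.prems by auto
    \<comment> \<open>The witnesses \<open>d1\<close> and \<open>d2\<close> come without sortedness;
      they inherit it by being equal to the \<open>d\<close> of the induction hypothesis.\<close>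
    have "d1 = d"
      using d d1 by (intro key_diagram_inject) auto
    moreover have "d2 = d"
      using d d2 eq by (intro key_diagram_inject) auto
    ultimately have snakes: "special_snake d (U ! i)" "special_snake d (V ! i)"
      using d1 d2 by auto
    have "card (U ! i) = card (V ! i)"
      using arg_cong[OF weight, of "\<lambda>w. w ! i"] Suc.prems len by (simp add: weight_def)
    with d(2) snakes have "U ! i = V ! i"
      by (rule special_snake_card_inject)
    moreover obtain a where a: "key_le a d" "key_diagram d - U ! i = key_diagram a"
      using snakes(1) by (auto simp: special_snake_def snake_def)
    moreover have "key_diagram a = key_diagram b - (\<Union>j<Suc i. U ! j)"
      using a(2) d(3) by (auto simp: lessThan_Suc)
    moreover have "sorted a" "length a = length b"
      using a(1) d key_le_sorted[OF a(1)] by (simp_all add: key_le_def)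
    ultimately show ?case
      using eq less_Suc_eq by auto
  qed
  from this[of "length b"] len show ?thesis
    by (auto intro: nth_equalityI)
qed

theorem theorem7p8:
  fixes n :: nat and \<mu> a :: "nat list"
  assumes "length \<mu> = n" and "sorted_wrt (\<ge>) \<mu>"
    and "length a = n"
  shows "cancellation_free tabloid_sign (special_snake_tabloids (rev \<mu>) a)"
proof -
  have "sorted (rev \<mu>)"
    using assms(2) by (simp add: sorted_wrt_rev)
  then have "U = V" if "U \<in> special_snake_tabloids (rev \<mu>) a" "V \<in> special_snake_tabloids (rev \<mu>) a" for U V
    using that by (auto simp: special_snake_tabloids_def intro: special_snake_tabloid_weight_inject)
  then show ?thesis
    \<comment> \<open>A positive and a negative term would belong to the same tabloid.\<close>
    unfolding cancellation_free_def by (metis less_asym)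
qed

end
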